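(* Let $m\geq 1$, let $\ell$ be a prime and $k\geq 1$, and suppose $a$ is a residue class modulo $m$ whose multiplicative order divides $\ell^k$. Let $j\geq 1$ and $d\geq 1$. If $d$ has at least $j\ell^k$ distinct prime factors $p$ with $p\equiv a\bmod m$, then $\ell^j$ divides $S_d(x)$ modulo $x^m-1$, i.e. there is $g(x)\in\mathbb{Z}[x]$ with $S_d(x)\equiv \ell^j g(x)\bmod x^m-1$ in $\mathbb{Z}[x]$.
   Context: $S_d(x):=\sum_{e\mid d}\mu(e)x^{d/e}\in\mathbb{Z}[x]$, where $\mu$ is the Möbius function. *)

theory Defs
  imports
    "HOL-Number_Theory.Number_Theory"
    "HOL-Computational_Algebra.Computational_Algebra"
begin

definition moebius_mu :: "nat \<Rightarrow> int" where
  "moebius_mu n = (if squarefree n then (- 1) ^ card (prime_factors n) else 0)"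

definition S_poly :: "nat \<Rightarrow> int poly" where
  "S_poly d = (\<Sum>e | e dvd d. smult (moebius_mu e) (monom 1 (d div e)))"

end

theory Submission
  imports Defs
begin

text \<open>Let \<open>\<psi>\<^sub>n\<close> be the substitution \<open>x \<mapsto> x\<^sup>n\<close> and \<open>T\<^sub>n = \<psi>\<^sub>n - 1\<close>. If \<open>d = p\<^sup>v c\<close> with \<open>v \<ge> 1\<close> and
  \<open>p\<close> a prime not dividing \<open>c\<close>, then \<open>S\<^sub>d = T\<^sub>p (\<psi> S\<^sub>c)\<close>, where \<open>\<psi>\<close> substitutes \<open>x\<close> to the power
  \<open>p\<close> to the \<open>v - 1\<close>. Modulo \<open>x\<^sup>m - 1\<close> the operator \<open>T\<^sub>p\<close> depends
  only on the class of \<open>p\<close>, so \<open>S\<^sub>d\<close> lies in the image of the \<open>n\<close>-th iterate of \<open>T\<^sub>a\<close>, \<open>n\<close> being the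
  number of prime factors in the class of \<open>a\<close>. With \<open>q = l\<^sup>k\<close>, the binomial theorem
  shows that the \<open>q\<close>-th iterate of \<open>T\<^sub>a\<close> agrees modulo \<open>l\<close> with \<open>T\<^sub>b\<close> for \<open>b = a\<^sup>q\<close>, and
  \<open>T\<^sub>b\<close> vanishes modulo \<open>x\<^sup>m - 1\<close> because \<open>b \<equiv> 1\<close> modulo \<open>m\<close>. So each block of \<open>q\<close>
  applications of \<open>T\<^sub>a\<close> gains a factor \<open>l\<close>.\<close>

section \<open>Substitution of powers of \<open>x\<close>\<close>

definition power_subst :: "nat \<Rightarrow> 'a::comm_ring_1 poly \<Rightarrow> 'a poly" where
  "power_subst n f = pcompose f (monom 1 n)"

definition power_diff :: "nat \<Rightarrow> 'a::comm_ring_1 poly \<Rightarrow> 'a poly" where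
  "power_diff n f = power_subst n f - f"

lemma power_subst_diff: "power_subst n (f - g) = power_subst n f - power_subst n g"
  by (simp add: power_subst_def pcompose_diff)

lemma power_subst_smult: "power_subst n (smult c f) = smult c (power_subst n f)"
  by (simp add: power_subst_def pcompose_smult)

lemma power_subst_sum: "power_subst n (sum f A) = (\<Sum>x\<in>A. power_subst n (f x))"
  by (simp add: power_subst_def pcompose_sum)

lemma power_subst_monom: "power_subst n (monom c k) = monom c (n * k)"
proof -
  have "pcompose (monom 1 k) (monom 1 n) = (monom 1 (n * k) :: 'a poly)"
    by (induction k) (simp_all add: monom_Suc pcompose_pCons mult_monom pcompose_1)
  moreover have "power_subst n (monom c k) = smult c (pcompose (monom 1 k) (monom 1 n))"
    by (simp add: power_subst_def pcompose_smult[symmetric] smult_monom)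
  ultimately show ?thesis
    by (simp add: smult_monom)
qed

lemma power_subst_1: "power_subst 1 f = f"
proof -
  have "monom 1 1 = ([:0, 1:] :: 'a poly)" by (simp add: monom_altdef)
  thus ?thesis by (simp add: power_subst_def)
qed

lemma power_subst_power_subst:
  fixes f :: "'a::comm_ring_1 poly"
  shows "power_subst n (power_subst k f) = power_subst (n * k) f"
  using power_subst_monom[of n "1::'a" k]
  by (simp add: power_subst_def pcompose_assoc[symmetric])

section \<open>Congruences modulo \<open>x^m - 1\<close>\<close>

lemma diff_dvd_pcompose_diff:
  fixes f u v :: "'a::comm_ring_1 poly"
  shows "(u - v) dvd (pcompose f u - pcompose f v)"
proof (induction f)
  case 0
  show ?case by simp
next
  case (pCons c f)
  have "pcompose (pCons c f) u - pcompose (pCons c f) v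
      = u * (pcompose f u - pcompose f v) + (u - v) * pcompose f v"
    by (simp add: pcompose_pCons algebra_simps)
  thus ?case using pCons.IH by simp
qed

lemma monom_minus_1_dvd: "(monom 1 m - 1 :: 'a::comm_ring_1 poly) dvd monom 1 (m * t) - 1"
proof -
  have "(monom 1 m - 1 :: 'a poly) dvd (monom 1 m) ^ t - 1 ^ t"
    by (simp only: power_diff_sumr2 dvd_triv_left)
  thus ?thesis by (simp add: monom_power)
qed

lemma monom_minus_1_dvd_monom_diff:
  assumes "[n = n'] (mod m)"
  shows "(monom 1 m - 1 :: 'a::comm_ring_1 poly) dvd monom 1 n - monom 1 n'"
proof -
  \<comment> \<open>With the larger exponent first, the difference factors as
    \<open>x^s * (x^(m*t) - 1)\<close>.\<close>
  have *: "(monom 1 m - 1 :: 'a poly) dvd monom 1 r - monom 1 s"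
    if le: "s \<le> r" and rs: "[r = s] (mod m)" for r s
  proof -
    obtain t where "r = t * m + s"
      using rs unfolding cong_le_nat[OF le] by blast
    hence "monom 1 r - monom 1 s = monom 1 s * (monom 1 (m * t) - 1 :: 'a poly)"
      by (simp add: right_diff_distrib mult_monom mult.commute add.commute)
    thus ?thesis by (metis dvd_mult monom_minus_1_dvd)
  qed
  show ?thesis
  proof (cases "n' \<le> n")
    case True
    thus ?thesis using * assms by blast
  next
    case False
    hence "(monom 1 m - 1 :: 'a poly) dvd monom 1 n' - monom 1 n"
      using *[of n n'] assms cong_sym by auto
    thus ?thesis by (metis dvd_minus_iff minus_diff_eq)
  qed
qed

text \<open>Congruent exponents give congruent arguments, and a polynomial takes congruent values at
  these. This is what allows a prime to be replaced by its residue class.\<close>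

lemma power_subst_cong:
  assumes "[n = n'] (mod m)"
  shows "(monom 1 m - 1) dvd (power_subst n f - power_subst n' f)"
  unfolding power_subst_def
  using monom_minus_1_dvd_monom_diff[OF assms] diff_dvd_pcompose_diff dvd_trans by blast

text \<open>The generator \<open>x^m - 1\<close> goes to its own multiple
  \<open>x^(m*n) - 1\<close>, so the substitution descends to the quotient ring.\<close>

lemma dvd_power_subst:
  fixes f :: "'a::comm_ring_1 poly"
  assumes "(monom 1 m - 1) dvd f"
  shows "(monom 1 m - 1) dvd power_subst n f"
proof -
  obtain g where "f = (monom 1 m - 1) * g" using assms by (elim dvdE)
  hence "power_subst n f = (monom 1 (m * n) - 1) * power_subst n g"
    using power_subst_monom[of n "1::'a" m]
    by (simp add: power_subst_def pcompose_mult pcompose_diff pcompose_1 mult.commute)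
  thus ?thesis by (metis dvd_mult2 monom_minus_1_dvd)
qed

section \<open>Iterates of the difference operator\<close>

lemma power_diff_diff: "power_diff n (f - g) = power_diff n f - power_diff n g"
  by (simp add: power_diff_def power_subst_diff)

lemma power_diff_smult: "power_diff n (smult c f) = smult c (power_diff n f)"
  by (simp add: power_diff_def power_subst_smult smult_diff_right)

lemma funpow_power_diff_diff:
  "(power_diff n ^^ N) (f - g) = (power_diff n ^^ N) f - (power_diff n ^^ N) g"
  by (induction N) (simp_all add: power_diff_diff)

lemma funpow_power_diff_smult:
  "(power_diff n ^^ N) (smult c f) = smult c ((power_diff n ^^ N) f)"
  by (induction N) (simp_all add: power_diff_smult)

lemma power_subst_power_diff: "power_subst k (power_diff n f) = power_diff n (power_subst k f)"
  by (simp add: power_diff_def power_subst_diff power_subst_power_subst mult.commute)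

lemma power_subst_funpow_power_diff:
  "power_subst k ((power_diff n ^^ N) f) = (power_diff n ^^ N) (power_subst k f)"
  by (induction N) (simp_all add: power_subst_power_diff)

lemma dvd_power_diff:
  "(monom 1 m - 1) dvd f \<Longrightarrow> (monom 1 m - 1) dvd power_diff n f"
  by (simp add: power_diff_def dvd_power_subst)

lemma dvd_funpow_power_diff:
  "(monom 1 m - 1) dvd f \<Longrightarrow> (monom 1 m - 1) dvd (power_diff n ^^ N) f"
  by (induction N) (simp_all add: dvd_power_diff)

text \<open>Since \<open>i\<close> substitutions compose to the one with exponent
  \<open>n ^ i\<close>, this is the binomial theorem for substitution minus identity. The sign
  exponent \<open>N + i\<close> has the parity of \<open>N - i\<close> without truncated
  subtraction.\<close>

lemma funpow_power_diff_binomial: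
  fixes f :: "'a::comm_ring_1 poly"
  shows "(power_diff n ^^ N) f =
    (\<Sum>i\<le>N. smult ((- 1) ^ (N + i) * of_nat (N choose i)) (power_subst (n ^ i) f))"
proof (induction N)
  case 0
  show ?case by (simp add: power_subst_1[unfolded One_nat_def])
next
  case (Suc N)
  define X where "X i = power_subst (n ^ i) f" for i
  define c :: "nat \<Rightarrow> 'a" where "c i = (- 1) ^ (N + i) * of_nat (N choose i)" for i
  have X_Suc: "power_subst n (X i) = X (Suc i)" for i
    by (simp add: X_def power_subst_power_subst)
  \<comment> \<open>The added term at \<open>Suc N\<close> is zero; it gives both sums the same
    range after the index shift, so that Pascal's rule applies termwise.\<close>
  have "(\<Sum>i\<le>N. smult (c i) (X i)) = (\<Sum>i\<le>Suc N. smult (c i) (X i))"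
    by (simp add: c_def binomial_eq_0)
  also have "\<dots> = smult (c 0) (X 0) + (\<Sum>i\<le>N. smult (c (Suc i)) (X (Suc i)))"
    by (rule sum.atMost_Suc_shift)
  finally have shift:
    "(\<Sum>i\<le>N. smult (c i) (X i)) = smult (c 0) (X 0) + (\<Sum>i\<le>N. smult (c (Suc i)) (X (Suc i)))" .
  have "(power_diff n ^^ Suc N) f = power_diff n (\<Sum>i\<le>N. smult (c i) (X i))"
    using Suc.IH by (simp add: c_def X_def)
  also have "\<dots> = (\<Sum>i\<le>N. smult (c i) (X (Suc i))) - (\<Sum>i\<le>N. smult (c i) (X i))"
    by (simp add: power_diff_def power_subst_sum power_subst_smult X_Suc)
  also have "\<dots> = smult (- c 0) (X 0) + (\<Sum>i\<le>N. smult (c i - c (Suc i)) (X (Suc i)))"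
    by (simp add: shift smult_diff_left sum_subtractf)
  also have "\<dots> = (\<Sum>i\<le>Suc N. smult ((- 1) ^ (Suc N + i) * of_nat (Suc N choose i)) (X i))"
    unfolding sum.atMost_Suc_shift[of _ N] by (simp add: c_def algebra_simps)
  finally show ?case by (simp add: X_def)
qed

text \<open>In the binomial expansion all coefficients with \<open>0 < i < l\<close> are divisible
  by \<open>l\<close>, so only the two end terms matter.\<close>

lemma funpow_power_diff_prime:
  fixes f :: "int poly"
  assumes "prime l"
  shows "[:int l:] dvd (power_diff n ^^ l) f - power_diff (n ^ l) f"
proof -
  have l: "l > 1" using assms prime_gt_1_nat by blast
  define t where
    "t i = smult ((- 1) ^ (l + i) * int (l choose i)) (power_subst (n ^ i) f)" for i
  have split: "{..l} = insert 0 (insert l {0<..<l})" by auto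
  have "(power_diff n ^^ l) f = sum t {..l}"
    unfolding t_def using funpow_power_diff_binomial[of l n f] by simp
  also have "\<dots> = t 0 + t l + sum t {0<..<l}"
    unfolding split using l by simp
  finally have sum: "(power_diff n ^^ l) f = t 0 + t l + sum t {0<..<l}" .
  have mid: "[:int l:] dvd sum t {0<..<l}"
  proof (rule dvd_sum)
    fix i assume "i \<in> {0<..<l}"
    hence "int l dvd int (l choose i)"
      using dvd_choose_prime[of i l] assms by auto
    thus "[:int l:] dvd t i"
      by (simp add: t_def const_poly_dvd_iff)
  qed
  have tl: "t l = power_subst (n ^ l) f"
    by (simp add: t_def)
  have t0: "t 0 = smult ((- 1) ^ l) f"
    by (simp add: t_def power_subst_1[unfolded One_nat_def])
  \<comment> \<open>For odd \<open>l\<close> this sum is zero; for \<open>l = 2\<close> the sign is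
    wrong, but the sum is \<open>2 f\<close>.\<close>
  have "[:int l:] dvd t 0 + f"
  proof (cases "l = 2")
    case True
    hence "t 0 + f = [:int l:] * f"
      using smult_add_left[of 1 1 f] by (simp add: t0)
    thus ?thesis by (metis dvd_triv_left)
  next
    case False
    hence "odd l" using assms l prime_odd_nat by auto
    thus ?thesis by (simp add: t0)
  qed
  moreover have "(power_diff n ^^ l) f - power_diff (n ^ l) f = (t 0 + f) + sum t {0<..<l}"
    by (simp add: sum tl power_diff_def)
  ultimately show ?thesis using mid by simp
qed

lemma const_dvd_funpow_power_diff:
  "[:c:] dvd f \<Longrightarrow> [:c:] dvd (power_diff n ^^ N) f"
  by (auto simp: dvd_def funpow_power_diff_smult)

text \<open>Iterating the congruence for \<open>l ^ k\<close> another \<open>l\<close> times reduces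
  the claim to the prime case with base \<open>n ^ (l ^ k)\<close>.\<close>

lemma funpow_power_diff_prime_power:
  fixes f :: "int poly"
  assumes "prime l"
  shows "[:int l:] dvd (power_diff n ^^ (l ^ k)) f - power_diff (n ^ (l ^ k)) f"
proof (induction k arbitrary: n f)
  case 0
  show ?case by simp
next
  case (Suc k)
  define T where "T = (power_diff n ^^ (l ^ k) :: int poly \<Rightarrow> int poly)"
  define T' where "T' = (power_diff (n ^ (l ^ k)) :: int poly \<Rightarrow> int poly)"
  have T: "[:int l:] dvd T g - T' g" for g
    using Suc.IH by (simp add: T_def T'_def)
  have iter: "[:int l:] dvd (T ^^ i) f - (T' ^^ i) f" for i
  proof (induction i)
    case 0
    show ?case by simp
  next
    case (Suc i)
    \<comment> \<open>Only \<open>T\<close> needs to be additive here: the second bracket compares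
      \<open>T\<close> and \<open>T'\<close> at one common argument.\<close>
    have "(T ^^ Suc i) f - (T' ^^ Suc i) f
        = T ((T ^^ i) f - (T' ^^ i) f) + (T ((T' ^^ i) f) - T' ((T' ^^ i) f))"
      by (simp add: T_def funpow_power_diff_diff)
    moreover have "[:int l:] dvd T ((T ^^ i) f - (T' ^^ i) f)"
      using Suc.IH const_dvd_funpow_power_diff unfolding T_def by blast
    ultimately show ?case using T by (metis dvd_add)
  qed
  have "T ^^ l = (power_diff n ^^ (l ^ Suc k) :: int poly \<Rightarrow> int poly)"
    by (simp add: T_def funpow_mult mult.commute)
  moreover have "[:int l:] dvd (T' ^^ l) f - power_diff (n ^ (l ^ Suc k)) f"
    using funpow_power_diff_prime[OF assms, of "n ^ (l ^ k)" f]
    by (simp add: T'_def power_mult[symmetric] mult.commute)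
  ultimately show ?case
    using dvd_add[OF iter[of l]] by fastforce
qed

lemma funpow_power_diff_order:
  fixes f :: "int poly"
  assumes "prime l" and "[a ^ (l ^ k) = 1] (mod m)"
  shows "\<exists>g. (monom 1 m - 1) dvd (power_diff a ^^ (l ^ k)) f - smult (int l) g"
proof -
  obtain g where "(power_diff a ^^ (l ^ k)) f - power_diff (a ^ (l ^ k)) f = [:int l:] * g"
    using funpow_power_diff_prime_power[OF assms(1)] unfolding dvd_def by blast
  hence "(power_diff a ^^ (l ^ k)) f - smult (int l) g = power_diff (a ^ (l ^ k)) f"
    by (simp add: algebra_simps)
  moreover have "(monom 1 m - 1) dvd power_diff (a ^ (l ^ k)) f"
    using power_subst_cong[OF assms(2), of f]
    by (simp add: power_diff_def power_subst_1[unfolded One_nat_def])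
  ultimately show ?thesis by metis
qed

text \<open>A further block keeps multiples of \<open>x^m - 1\<close> and commutes with the scalar
  \<open>l^j\<close>; applied to \<open>g\<close> it yields the next factor
  \<open>l\<close>.\<close>

lemma funpow_power_diff_order_mult:
  fixes f :: "int poly"
  assumes "prime l" and "[a ^ (l ^ k) = 1] (mod m)"
  shows "\<exists>g. (monom 1 m - 1) dvd (power_diff a ^^ (j * l ^ k)) f - smult (int l ^ j) g"
proof (induction j)
  case 0
  show ?case by (intro exI[of _ f]) simp
next
  case (Suc j)
  define T where "T = (power_diff a ^^ (l ^ k) :: int poly \<Rightarrow> int poly)"
  define F where "F = (power_diff a ^^ (j * l ^ k)) f"
  obtain g where g: "(monom 1 m - 1) dvd F - smult (int l ^ j) g"
    using Suc.IH by (auto simp: F_def)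
  obtain h where h: "(monom 1 m - 1) dvd T g - smult (int l) h"
    using funpow_power_diff_order[OF assms] by (auto simp: T_def)
  have "(monom 1 m - 1) dvd T (F - smult (int l ^ j) g)"
    unfolding T_def by (rule dvd_funpow_power_diff[OF g])
  hence "(monom 1 m - 1) dvd T F - smult (int l ^ j) (T g)"
    by (simp add: T_def funpow_power_diff_diff funpow_power_diff_smult)
  moreover have "(monom 1 m - 1) dvd smult (int l ^ j) (T g - smult (int l) h)"
    using h by (rule dvd_smult)
  ultimately have "(monom 1 m - 1) dvd
      (T F - smult (int l ^ j) (T g)) + smult (int l ^ j) (T g - smult (int l) h)"
    by (rule dvd_add)
  hence "(monom 1 m - 1) dvd T F - smult (int l ^ Suc j) h"
    by (simp add: smult_diff_right mult.commute)
  moreover have "T F = (power_diff a ^^ (Suc j * l ^ k)) f"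
    by (simp add: T_def F_def funpow_add)
  ultimately show ?case by metis
qed

section \<open>Prime factors and the polynomials \<open>S_poly\<close>\<close>

lemma moebius_mu_prime_mult:
  assumes "prime p" and "\<not> p dvd e"
  shows "moebius_mu (p * e) = - moebius_mu e"
proof -
  have cop: "coprime p e" using assms prime_imp_coprime by blast
  have e: "e \<noteq> 0" using assms(2) by (metis dvd_0_right)
  have "prime_factors (p * e) = insert p (prime_factors e)"
    using assms e by (simp add: prime_factors_product prime_prime_factors prime_gt_0_nat)
  moreover have "p \<notin> prime_factors e" using assms by auto
  moreover have "squarefree (p * e) \<longleftrightarrow> squarefree e"
    using cop squarefree_mult_coprime[of p e] squarefree_multD(2)[of p e] squarefree_prime[of p] assms(1)
    by auto
  ultimately show ?thesis by (simp add: moebius_mu_def)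
qed

text \<open>Squarefree divisors of \<open>d\<close> contain \<open>p\<close> at most once, so they
  are of the form \<open>e\<close> or \<open>p * e\<close> with \<open>e dvd c\<close>. The two
  families give the two terms of the difference operator.\<close>

lemma S_poly_prime_power_mult:
  assumes "prime p" and "\<not> p dvd c"
  shows "S_poly (p ^ Suc v * c) = power_diff p (power_subst (p ^ v) (S_poly c))"
proof -
  define d where "d = p ^ Suc v * c"
  define t where "t e = smult (moebius_mu e) (monom 1 (d div e))" for e
  have p: "p > 0" using assms prime_gt_0_nat by blast
  have c: "c > 0" using assms by (cases c) auto
  have d: "d > 0" using p c by (simp add: d_def)
  define A where "A = {e. e dvd c}"
  have A: "finite A" "\<And>e. e \<in> A \<Longrightarrow> \<not> p dvd e"
    using c assms by (auto simp: A_def intro: dvd_trans)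
  have zero: "t e = 0" if "e \<in> {e. e dvd d} - (A \<union> (*) p ` A)" for e
  proof (rule ccontr)
    assume "t e \<noteq> 0"
    hence sq: "squarefree e" by (auto simp: t_def moebius_mu_def split: if_splits)
    have e: "e dvd p ^ Suc v * c" using that by (simp add: d_def)
    show False
    proof (cases "p dvd e")
      case False
      hence "coprime e (p ^ Suc v)"
        using assms by (metis coprime_commute coprime_power_right_iff prime_imp_coprime)
      hence "e dvd c" using e by (simp add: coprime_dvd_mult_right_iff)
      thus False using that by (simp add: A_def)
    next
      case True
      then obtain e' where e': "e = p * e'" by (elim dvdE)
      have "\<not> p dvd e'"
      proof
        assume "p dvd e'"
        hence "p ^ 2 dvd e" by (simp add: e' power2_eq_square mult_dvd_mono)
        hence "p dvd 1" using sq squarefreeD by blast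
        thus False using assms by auto
      qed
      hence "coprime e' (p ^ Suc v)"
        using assms by (metis coprime_commute coprime_power_right_iff prime_imp_coprime)
      moreover have "e' dvd p ^ Suc v * c" using e e' dvd_mult_right by blast
      ultimately have "e' dvd c" by (simp add: coprime_dvd_mult_right_iff)
      thus False using that by (auto simp: A_def e')
    qed
  qed
  have sub: "A \<union> (*) p ` A \<subseteq> {e. e dvd d}"
    by (auto simp: A_def d_def intro: mult_dvd_mono)
  have disj: "A \<inter> (*) p ` A = {}" by (auto dest: A(2))
  have inj: "inj_on ((*) p) A" using p by (auto intro: inj_onI)
  have "S_poly d = sum t {e. e dvd d}" by (simp add: S_poly_def t_def)
  also have "\<dots> = sum t (A \<union> (*) p ` A)"
    using zero sub d by (intro sum.mono_neutral_right) auto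
  also have "\<dots> = sum t A + (\<Sum>e\<in>A. t (p * e))"
    using A(1) disj inj by (simp add: sum.union_disjoint sum.reindex)
  also have "sum t A = power_subst (p ^ Suc v) (S_poly c)"
    unfolding S_poly_def power_subst_sum A_def
    by (intro sum.cong refl)
      (simp add: t_def d_def power_subst_smult power_subst_monom div_mult_swap)
  \<comment> \<open>The extra \<open>p\<close> flips the Moebius sign and lowers the exponent of
    \<open>p\<close> in the quotient from \<open>Suc v\<close> to \<open>v\<close>.\<close>
  also have "(\<Sum>e\<in>A. t (p * e)) = - power_subst (p ^ v) (S_poly c)"
    unfolding S_poly_def power_subst_sum A_def sum_negf[symmetric]
  proof (intro sum.cong refl)
    fix e assume "e \<in> {e. e dvd c}"
    moreover from this have "\<not> p dvd e" using A(2) by (simp add: A_def)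
    moreover have "d div (p * e) = (p ^ v * c) div e"
      using p by (simp add: d_def mult.assoc)
    ultimately show "t (p * e) = - power_subst (p ^ v) (smult (moebius_mu e) (monom 1 (c div e)))"
      using assms
      by (simp add: t_def power_subst_smult power_subst_monom div_mult_swap moebius_mu_prime_mult)
  qed
  finally show ?thesis
    by (simp add: d_def power_diff_def power_subst_power_subst)
qed

text \<open>Splitting off the full power of one prime in the class costs exactly one such prime and
  produces one operator, which is congruent to \<open>power_diff a\<close>.\<close>

lemma S_poly_funpow_power_diff:
  assumes "d > 0" and "n \<le> card {p \<in> prime_factors d. [p = a] (mod m)}"
  shows "\<exists>f. (monom 1 m - 1) dvd S_poly d - (power_diff a ^^ n) f"
  using assms
proof (induction n arbitrary: d)
  case 0
  show ?case by (intro exI[of _ "S_poly d"]) simp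
next
  case (Suc n)
  define P where "P d = {p \<in> prime_factors d. [p = a] (mod m)}" for d
  have "card (P d) \<noteq> 0" using Suc.prems(2) unfolding P_def by linarith
  hence "P d \<noteq> {}" by force
  then obtain p where p: "p \<in> prime_factors d" "[p = a] (mod m)" by (auto simp: P_def)
  hence pr: "prime p" "p dvd d" by auto
  obtain c where c: "d = p ^ multiplicity p d * c" "\<not> p dvd c"
    using multiplicity_decompose'[of d p] Suc.prems pr by (metis gr_implies_not0 not_prime_unit)
  have "multiplicity p d > 0" using p(1) by (simp add: prime_factors_multiplicity)
  then obtain v where v: "d = p ^ Suc v * c" using c(1) by (metis Suc_pred')
  have c0: "c > 0" using v Suc.prems by (cases c) auto
  have "prime_factors d = insert p (prime_factors c)"
    using v c0 pr
    by (simp add: prime_factors_product prime_factors_power prime_prime_factors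
          prime_gt_0_nat del: power_Suc)
  hence "P d = insert p (P c)" using p by (auto simp: P_def)
  moreover have "p \<notin> P c" using c(2) by (auto simp: P_def)
  moreover have "finite (P c)" by (simp add: P_def)
  ultimately have "n \<le> card (P c)" using Suc.prems by (simp add: P_def)
  then obtain f where f: "(monom 1 m - 1) dvd S_poly c - (power_diff a ^^ n) f"
    using Suc.IH[OF c0] by (auto simp: P_def)
  define g where "g = power_subst (p ^ v) (S_poly c)"
  \<comment> \<open>The leftover substitution by \<open>p ^ v\<close> commutes with the difference
    operators and is absorbed into the witness.\<close>
  have "(monom 1 m - 1) dvd g - (power_diff a ^^ n) (power_subst (p ^ v) f)"
    using dvd_power_subst[OF f, of "p ^ v"]
    by (simp add: power_subst_diff power_subst_funpow_power_diff g_def)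
  from dvd_power_diff[OF this, of a]
  have "(monom 1 m - 1) dvd power_diff a g - (power_diff a ^^ Suc n) (power_subst (p ^ v) f)"
    by (simp add: power_diff_diff)
  moreover have "(monom 1 m - 1) dvd S_poly d - power_diff a g"
    using power_subst_cong[OF p(2), of g]
    unfolding v S_poly_prime_power_mult[OF pr(1) c(2)] g_def[symmetric]
    by (simp add: power_diff_def)
  ultimately have "(monom 1 m - 1) dvd (S_poly d - power_diff a g)
      + (power_diff a g - (power_diff a ^^ Suc n) (power_subst (p ^ v) f))"
    by (simp only: dvd_add)
  thus ?case by (intro exI[of _ "power_subst (p ^ v) f"]) simp
qed

theorem theorem2p25:
  fixes m l k a j d :: nat
  assumes "m \<ge> 1"
    and "prime l" and "k \<ge> 1"
    and "coprime a m" and "ord m a dvd l ^ k"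
    and "j \<ge> 1" and "d \<ge> 1"
    and "card {p \<in> prime_factors d. [p = a] (mod m)} \<ge> j * l ^ k"
  shows "\<exists>g :: int poly. (monom 1 m - 1) dvd (S_poly d - smult (int l ^ j) g)"
proof -
  have a: "[a ^ (l ^ k) = 1] (mod m)"
    using assms(5) ord_divides by blast
  obtain f where f: "(monom 1 m - 1) dvd S_poly d - (power_diff a ^^ (j * l ^ k)) f"
    using S_poly_funpow_power_diff[of d "j * l ^ k" a m] assms by auto
  obtain g where "(monom 1 m - 1) dvd (power_diff a ^^ (j * l ^ k)) f - smult (int l ^ j) g"
    using funpow_power_diff_order_mult[OF assms(2) a] by blast
  from dvd_add[OF f this] show ?thesis by auto
qed

end
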